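(* Let $\phi$ be an updating rule, $\mathcal{P}$ a class of true densities, and $\Omega_{t-1}$ a (symmetric) positive definite $k\times k$ weighting matrix known given $\mathcal{F}_{t-1}$. Assume: (1) $\Theta\subseteq\mathbb{R}^k$ is open and convex, $\vartheta_{t|t-1}\in\Theta$ and $\vartheta_{t|t}(Y_t)=\phi(Y_t,\vartheta_{t|t-1})\in\Theta$ (almost surely); (2) $\log f(x|\vartheta)$ is twice continuously differentiable in $\vartheta$ for all $\vartheta\in\Theta$ and $x\in\mathcal{Y}$; (3) $\mathbb{E}_{p_t}[s(X_t,\vartheta_{t|t-1})]$ and $\mathbb{E}_{p_t}[\|\Delta\phi(Y_t,\vartheta_{t|t-1})\|^2]$ are finite for all $\vartheta_{t|t-1}\in\Theta$ and $p_t\in\mathcal{P}$. Then, for all $p_t\in\mathcal{P}$ and $\vartheta_{t|t-1}\in\Theta$, the following are equivalent: (a) $\mathbb{E}_{p_t}[\Delta\phi(Y_t,\vartheta_{t|t-1})]^\top\,\Omega_{t-1}\,(\vartheta_t^\ast-\vartheta_{t|t-1})>0$; (b) there exists $\bar\kappa>0$ (with $\bar\kappa\le1$) such that for all $\kappa\in(0,\bar\kappa]$: $\Delta^{\mathsf{CEV}}(\phi_\kappa|\vartheta_{t|t-1},p_t)<0$.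
   Context: Setting. Let $\mathcal{Y}\subseteq\mathbb{R}^l$ be the outcome space and fix a time $t$. Conditionally on the information set $\mathcal{F}_{t-1}$ at time $t-1$, the observation $Y_t$ has true density $p_t$ on $\mathcal{Y}$, belonging to a class $\mathcal{P}$ of absolutely continuous distributions. Quantities known given $\mathcal{F}_{t-1}$, such as the predicted parameter $\vartheta_{t|t-1}\in\Theta$ and $\Omega_{t-1}$, are treated as fixed. $\mathbb{E}_{p_t}$ denotes expectation under $p_t$, and $X_t$ denotes an independent copy of $Y_t$. The postulated (possibly misspecified) model is a family of densities $f(\cdot|\vartheta)$, $\vartheta\in\Theta\subseteq\mathbb{R}^k$; the support of $p_t$ is contained in the support of $f(\cdot|\vartheta)$ for all $\vartheta\in\Theta$. The score is $s(y,\vartheta)=\frac{\partial}{\partial\vartheta}\log f(y|\vartheta)$. $\|\cdot\|$ is the Euclidean norm. The pseudo-true parameter is $\vartheta_t^\ast:=\arg\max_{\vartheta\in\Theta}\mathbb{E}_{p_t}[\log f(Y_t|\vartheta)]$, assumed to exist in $\Theta$. Updating rules. An updating rule is a map $\phi:\mathcal{Y}\times\Theta\to\Theta$; the updated parameter is $\vartheta_{t|t}(y)=\phi(y,\vartheta_{t|t-1})$ and $\Delta\phi(y,\vartheta_{t|t-1}):=\vartheta_{t|t}(y)-\vartheta_{t|t-1}$. For $0<\kappa\le 1$, the linearly downscaled rule is $\phi_\kappa(y,\vartheta_{t|t-1})=\vartheta_{t|t-1}+\kappa\,\Delta\phi(y,\vartheta_{t|t-1})$. CEV (conditional expected variation).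 For an updating rule $\phi$ with updated parameter $\vartheta_{t|t}(Y_t)$, $$\mathsf{CEV}(p_t\Vert f_{t|t}):=\big(\mathbb{E}_{p_t}[\vartheta_{t|t}(Y_t)]-\vartheta_t^\ast\big)^\top\Omega_{t-1}\big(\mathbb{E}_{p_t}[\vartheta_{t|t}(Y_t)]-\vartheta_t^\ast\big),$$ $\mathsf{CEV}(p_t\Vert f_{t|t-1})$ is the same expression with $\vartheta_{t|t}(Y_t)$ replaced by $\vartheta_{t|t-1}$, and $\Delta^{\mathsf{CEV}}(\phi|\vartheta_{t|t-1},p_t):=\mathsf{CEV}(p_t\Vert f_{t|t})-\mathsf{CEV}(p_t\Vert f_{t|t-1})$. *)

theory Defs
  imports "HOL-Probability.Probability"
begin

section \<open>Distributions given by a density on the outcome space\<close>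

definition law :: "(real^'l) set \<Rightarrow> (real^'l \<Rightarrow> real) \<Rightarrow> (real^'l) measure" where
  "law Y p = density (restrict_space lborel Y) (\<lambda>y. ennreal (p y))"

definition prob_density_on :: "(real^'l) set \<Rightarrow> (real^'l \<Rightarrow> real) \<Rightarrow> bool" where
  "prob_density_on Y p \<longleftrightarrow>
     p \<in> borel_measurable (restrict_space borel Y) \<and> (\<forall>y\<in>Y. 0 \<le> p y) \<and> prob_space (law Y p)"

definition density_support :: "(real^'l) set \<Rightarrow> (real^'l \<Rightarrow> real) \<Rightarrow> (real^'l) set" where
  "density_support Y p = {y\<in>Y. 0 < p y}"

definition symmetric_pos_def :: "real^'k^'k \<Rightarrow> bool" where
  "symmetric_pos_def A \<longleftrightarrow> transpose A = A \<and> (\<forall>x. x \<noteq> 0 \<longrightarrow> 0 < x \<bullet> (A *v x))"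

section \<open>Log-likelihood, score and pseudo-true parameter\<close>

text \<open>
  The last argument of a model f is the parameter: \<open>f y \<theta>\<close> is the model density
  at the outcome y.
\<close>

definition log_lik :: "(real^'l \<Rightarrow> real^'k \<Rightarrow> real) \<Rightarrow> real^'l \<Rightarrow> real^'k \<Rightarrow> real" where
  "log_lik f y \<theta> = ln (f y \<theta>)"

definition twice_cont_differentiable_on :: "(real^'k) set \<Rightarrow> (real^'k \<Rightarrow> real) \<Rightarrow> bool" where
  "twice_cont_differentiable_on S F \<longleftrightarrow>
     (\<exists>(G :: real^'k \<Rightarrow> real^'k) (H :: real^'k \<Rightarrow> real^'k^'k).
        (\<forall>x\<in>S. GDERIV F x :> G x) \<and>
        (\<forall>x\<in>S. (G has_derivative (\<lambda>h. H x *v h)) (at x)) \<and>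
        continuous_on S H)"

definition score :: "(real^'l \<Rightarrow> real^'k \<Rightarrow> real) \<Rightarrow> real^'l \<Rightarrow> real^'k \<Rightarrow> real^'k" where
  "score f y \<theta> = (\<chi> i. frechet_derivative (log_lik f y) (at \<theta>) (axis i 1))"

text \<open>
  The expected log-likelihood may be infinite at some parameters, where the Bochner integral
  would return the default value 0.  It is therefore taken in the extended reals, as the
  integral of the positive part minus that of the negative part (\<open>ennreal\<close> maps negative
  numbers to 0), provided these are not both infinite.
\<close>

definition ext_expectation_defined :: "'a measure \<Rightarrow> ('a \<Rightarrow> real) \<Rightarrow> bool" where
  "ext_expectation_defined M g \<longleftrightarrow>
     g \<in> borel_measurable M \<and>
     ((\<integral>\<^sup>+ y. ennreal (g y) \<partial>M) < \<infinity> \<or> (\<integral>\<^sup>+ y. ennreal (- g y) \<partial>M) < \<infinity>)"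

definition ext_expectation :: "'a measure \<Rightarrow> ('a \<Rightarrow> real) \<Rightarrow> ereal" where
  "ext_expectation M g =
     enn2ereal (\<integral>\<^sup>+ y. ennreal (g y) \<partial>M) - enn2ereal (\<integral>\<^sup>+ y. ennreal (- g y) \<partial>M)"

text \<open>The maximizer is not required to be unique.\<close>

definition is_pseudo_true ::
    "(real^'l) set \<Rightarrow> (real^'k) set \<Rightarrow> (real^'l \<Rightarrow> real^'k \<Rightarrow> real) \<Rightarrow> (real^'l \<Rightarrow> real)
      \<Rightarrow> real^'k \<Rightarrow> bool" where
  "is_pseudo_true Y \<Theta> f p \<theta>s \<longleftrightarrow>
     (\<forall>\<theta>\<in>\<Theta>. ext_expectation_defined (law Y p) (\<lambda>y. log_lik f y \<theta>)) \<and>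
     is_arg_max (\<lambda>\<theta>. ext_expectation (law Y p) (\<lambda>y. log_lik f y \<theta>)) (\<lambda>\<theta>. \<theta> \<in> \<Theta>) \<theta>s"

section \<open>Updating rules and conditional expected variation\<close>

text \<open>Measurability in the outcome makes the updated parameter a random vector.\<close>

definition updating_rule ::
    "(real^'l) set \<Rightarrow> (real^'k) set \<Rightarrow> (real^'l \<Rightarrow> real^'k \<Rightarrow> real^'k) \<Rightarrow> bool" where
  "updating_rule Y \<Theta> \<phi> \<longleftrightarrow>
     (\<forall>y\<in>Y. \<forall>\<theta>\<in>\<Theta>. \<phi> y \<theta> \<in> \<Theta>) \<and>
     (\<forall>\<theta>\<in>\<Theta>. (\<lambda>y. \<phi> y \<theta>) \<in> borel_measurable (restrict_space borel Y))"

definition increment ::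
    "(real^'l \<Rightarrow> real^'k \<Rightarrow> real^'k) \<Rightarrow> real^'l \<Rightarrow> real^'k \<Rightarrow> real^'k" where
  "increment \<phi> y \<theta> = \<phi> y \<theta> - \<theta>"

definition downscaled ::
    "(real^'l \<Rightarrow> real^'k \<Rightarrow> real^'k) \<Rightarrow> real \<Rightarrow> real^'l \<Rightarrow> real^'k \<Rightarrow> real^'k" where
  "downscaled \<phi> \<kappa> y \<theta> = \<theta> + \<kappa> *\<^sub>R increment \<phi> y \<theta>"

text \<open>
  The argument u is the parameter as a function of the outcome: the updated parameter
  \<open>\<lambda>y. \<phi> y \<theta>\<close>, or the constant \<open>\<lambda>_. \<theta>\<close> for the predicted one; \<open>\<theta>s\<close> is the pseudo-true
  parameter of p.
\<close>

definition CEV ::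
    "(real^'l) set \<Rightarrow> real^'k^'k \<Rightarrow> real^'k \<Rightarrow> (real^'l \<Rightarrow> real) \<Rightarrow> (real^'l \<Rightarrow> real^'k) \<Rightarrow> real" where
  "CEV Y \<Omega> \<theta>s p u =
     (integral\<^sup>L (law Y p) u - \<theta>s) \<bullet> (\<Omega> *v (integral\<^sup>L (law Y p) u - \<theta>s))"

definition delta_CEV ::
    "(real^'l) set \<Rightarrow> real^'k^'k \<Rightarrow> real^'k \<Rightarrow> (real^'l \<Rightarrow> real^'k \<Rightarrow> real^'k) \<Rightarrow> real^'k
      \<Rightarrow> (real^'l \<Rightarrow> real) \<Rightarrow> real" where
  "delta_CEV Y \<Omega> \<theta>s \<phi> \<theta> p = CEV Y \<Omega> \<theta>s p (\<lambda>y. \<phi> y \<theta>) - CEV Y \<Omega> \<theta>s p (\<lambda>_. \<theta>)"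

end

theory Submission
  imports Defs
begin

text \<open>
  Since \<open>law Y p\<close> is a probability measure, the mean of the downscaled update is
  \<open>\<theta> + \<kappa> m\<close>, where m is the mean increment.  The change in \<open>CEV\<close> is
  therefore the difference of a quadratic form at \<open>a + \<kappa> m\<close> and at a, where
  \<open>a = \<theta> - \<theta>s\<close>, that is, a quadratic polynomial in \<open>\<kappa>\<close> without constant term:
  \<open>\<kappa> (\<kappa> m \<bullet> \<Omega> m - 2 m \<bullet> \<Omega> (\<theta>s - \<theta>))\<close>.  The sign of its linear coefficient decides
  its sign for small \<open>\<kappa>\<close>.  If that coefficient vanishes, then the quadratic term, which is
  nonnegative, makes the change nonnegative; this is why the strict inequalities on the two
  sides correspond exactly.  The first step is \<open>delta_CEV_downscaled\<close>, the second
  \<open>quadratic_neg_near_zero_iff\<close>; the mean increment exists because a square-integrable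
  vector is integrable under a finite measure.
\<close>

lemma integrable_of_integrable_norm_square:
  fixes g :: "'a \<Rightarrow> 'b::{banach, second_countable_topology}"
  assumes "finite_measure M"
    and meas: "g \<in> borel_measurable M"
    and square: "integrable M (\<lambda>x. (norm (g x))\<^sup>2)"
  shows "integrable M g"
proof -
  interpret finite_measure M by fact
  have "integrable M (\<lambda>x. norm (g x))"
    by (rule square_integrable_imp_integrable) (use meas square in simp_all)
  then show ?thesis
    using integrable_norm_iff[OF meas] by simp
qed

lemma integrable_increment:
  assumes dens: "prob_density_on Y p"
    and rule: "updating_rule Y \<Theta> \<phi>"
    and "\<theta> \<in> \<Theta>"
    and square: "integrable (law Y p) (\<lambda>y. (norm (increment \<phi> y \<theta>))\<^sup>2)"
  shows "integrable (law Y p) (\<lambda>y. increment \<phi> y \<theta>)"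
proof (rule integrable_of_integrable_norm_square[OF _ _ square])
  show "finite_measure (law Y p)"
    using dens by (simp add: prob_density_on_def prob_space_def)
  have "(\<lambda>y. \<phi> y \<theta>) \<in> borel_measurable (restrict_space borel Y)"
    using rule \<open>\<theta> \<in> \<Theta>\<close> by (simp add: updating_rule_def)
  moreover have "sets (law Y p) = sets (restrict_space borel Y)"
    by (simp add: law_def sets_restrict_space)
  ultimately have "(\<lambda>y. \<phi> y \<theta>) \<in> borel_measurable (law Y p)"
    using measurable_cong_sets by blast
  then show "(\<lambda>y. increment \<phi> y \<theta>) \<in> borel_measurable (law Y p)"
    unfolding increment_def by simp
qed

lemma quadratic_form_add_scaled:
  fixes A :: "real^'k^'k"
  assumes "transpose A = A"
  shows "(a + \<kappa> *\<^sub>R m) \<bullet> (A *v (a + \<kappa> *\<^sub>R m))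
    = a \<bullet> (A *v a) + 2 * \<kappa> * (m \<bullet> (A *v a)) + \<kappa>\<^sup>2 * (m \<bullet> (A *v m))"
proof -
  have "a \<bullet> (A *v m) = (transpose A *v a) \<bullet> m"
    by (simp add: dot_lmul_matrix transpose_matrix_vector)
  also have "\<dots> = m \<bullet> (A *v a)"
    by (simp only: assms inner_commute)
  finally have "a \<bullet> (A *v m) = m \<bullet> (A *v a)" .
  then show ?thesis
    by (simp add: matrix_vector_right_distrib matrix_vector_mult_scaleR
        inner_add_left inner_add_right power2_eq_square algebra_simps)
qed

lemma delta_CEV_downscaled:
  assumes "prob_space (law Y p)"
    and int: "integrable (law Y p) (\<lambda>y. increment \<phi> y \<theta>)"
    and sym: "transpose \<Omega> = \<Omega>"
  defines "m \<equiv> integral\<^sup>L (law Y p) (\<lambda>y. increment \<phi> y \<theta>)"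
  shows "delta_CEV Y \<Omega> \<theta>s (downscaled \<phi> \<kappa>) \<theta> p
    = \<kappa> * (\<kappa> * (m \<bullet> (\<Omega> *v m)) - 2 * (m \<bullet> (\<Omega> *v (\<theta>s - \<theta>))))"
proof -
  interpret prob_space "law Y p" by fact
  have mean: "integral\<^sup>L (law Y p) (\<lambda>y. downscaled \<phi> \<kappa> y \<theta>) - \<theta>s = (\<theta> - \<theta>s) + \<kappa> *\<^sub>R m"
    using int by (simp add: downscaled_def m_def prob_space)
  have flip: "m \<bullet> (\<Omega> *v (\<theta> - \<theta>s)) = - (m \<bullet> (\<Omega> *v (\<theta>s - \<theta>)))"
    by (simp add: matrix_vector_mult_diff_distrib inner_diff_right)
  have "delta_CEV Y \<Omega> \<theta>s (downscaled \<phi> \<kappa>) \<theta> p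
      = 2 * \<kappa> * (m \<bullet> (\<Omega> *v (\<theta> - \<theta>s))) + \<kappa>\<^sup>2 * (m \<bullet> (\<Omega> *v m))"
    unfolding delta_CEV_def CEV_def mean quadratic_form_add_scaled[OF sym]
    by (simp add: prob_space)
  then show ?thesis
    unfolding flip by (simp add: power2_eq_square algebra_simps)
qed

text \<open>
  Evaluating at a single \<open>\<kappa>\<close> already gives \<open>2 * c > \<kappa> * q \<ge> 0\<close>; conversely, \<open>\<kappa> * q < 2 * c\<close>
  as soon as \<open>\<kappa>\<close> is small compared with \<open>c\<close>.
\<close>

lemma quadratic_neg_near_zero_iff:
  fixes c q :: real
  assumes "0 \<le> q"
  shows "0 < c \<longleftrightarrow>
    (\<exists>\<kappa>bar>0. \<kappa>bar \<le> 1 \<and> (\<forall>\<kappa>. 0 < \<kappa> \<and> \<kappa> \<le> \<kappa>bar \<longrightarrow> \<kappa> * (\<kappa> * q - 2 * c) < 0))"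
    (is "_ \<longleftrightarrow> ?neg")
proof
  assume "0 < c"
  \<comment> \<open>The denominator is \<open>q + 1\<close> rather than \<open>q\<close> because \<open>q\<close> may vanish.\<close>
  let ?k = "min 1 (c / (q + 1))"
  have "\<kappa> * (\<kappa> * q - 2 * c) < 0" if "0 < \<kappa>" "\<kappa> \<le> ?k" for \<kappa>
  proof -
    have "\<kappa> * (q + 1) \<le> c"
      using that assms by (simp add: pos_le_divide_eq)
    then have "\<kappa> * q < 2 * c"
      using \<open>0 < \<kappa>\<close> \<open>0 < c\<close> by (simp add: distrib_left)
    then show ?thesis
      using \<open>0 < \<kappa>\<close> by (simp add: mult_less_0_iff)
  qed
  moreover have "0 < ?k"
    using \<open>0 < c\<close> assms by simp
  ultimately show ?neg
    by (intro exI[of _ ?k]) simp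
next
  assume ?neg
  then obtain \<kappa> where "0 < \<kappa>" and "\<kappa> * (\<kappa> * q - 2 * c) < 0"
    by blast
  then have "\<kappa> * q < 2 * c"
    by (simp add: mult_less_0_iff)
  moreover have "0 \<le> \<kappa> * q"
    using \<open>0 < \<kappa>\<close> assms by simp
  ultimately show "0 < c"
    by linarith
qed

theorem proposition2:
  fixes Y :: "(real^'l) set"
    and \<Theta> :: "(real^'k) set"
    and P :: "(real^'l \<Rightarrow> real) set"
    and f :: "real^'l \<Rightarrow> real^'k \<Rightarrow> real"
    and \<phi> :: "real^'l \<Rightarrow> real^'k \<Rightarrow> real^'k"
    and \<Omega> :: "real^'k^'k"
    and \<theta>star :: "(real^'l \<Rightarrow> real) \<Rightarrow> real^'k"
  assumes outcome_space: "Y \<in> sets borel"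
    and true_densities: "\<forall>p\<in>P. prob_density_on Y p"
    and model: "\<forall>\<theta>\<in>\<Theta>. prob_density_on Y (\<lambda>y. f y \<theta>)"
    and support: "\<forall>p\<in>P. \<forall>\<theta>\<in>\<Theta>. density_support Y p \<subseteq> density_support Y (\<lambda>y. f y \<theta>)"
    and pseudo_true: "\<forall>p\<in>P. is_pseudo_true Y \<Theta> f p (\<theta>star p)"
    and rule: "updating_rule Y \<Theta> \<phi>"
    and weight: "symmetric_pos_def \<Omega>"
    and domain: "open \<Theta>" "convex \<Theta>"
    and update_in: "\<forall>p\<in>P. \<forall>\<theta>\<in>\<Theta>. AE y in law Y p. \<phi> y \<theta> \<in> \<Theta>"
    and log_lik_real: "\<forall>y\<in>Y. \<forall>\<theta>\<in>\<Theta>. 0 < f y \<theta>"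
    and log_lik_C2: "\<forall>y\<in>Y. twice_cont_differentiable_on \<Theta> (log_lik f y)"
    and score_finite: "\<forall>p\<in>P. \<forall>\<theta>\<in>\<Theta>. integrable (law Y p) (\<lambda>y. score f y \<theta>)"
    and increment_finite:
      "\<forall>p\<in>P. \<forall>\<theta>\<in>\<Theta>. integrable (law Y p) (\<lambda>y. (norm (increment \<phi> y \<theta>))\<^sup>2)"
  shows "\<forall>p\<in>P. \<forall>\<theta>\<in>\<Theta>.
    0 < integral\<^sup>L (law Y p) (\<lambda>y. increment \<phi> y \<theta>) \<bullet> (\<Omega> *v (\<theta>star p - \<theta>)) \<longleftrightarrow>
    (\<exists>\<kappa>bar>0. \<kappa>bar \<le> 1 \<and>
       (\<forall>\<kappa>. 0 < \<kappa> \<and> \<kappa> \<le> \<kappa>bar \<longrightarrow> delta_CEV Y \<Omega> (\<theta>star p) (downscaled \<phi> \<kappa>) \<theta> p < 0))"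
proof (intro ballI)
  fix p \<theta>
  assume p: "p \<in> P" and \<theta>: "\<theta> \<in> \<Theta>"
  let ?m = "integral\<^sup>L (law Y p) (\<lambda>y. increment \<phi> y \<theta>)"
  have sym: "transpose \<Omega> = \<Omega>"
    using weight by (simp add: symmetric_pos_def_def)
  have nonneg: "0 \<le> ?m \<bullet> (\<Omega> *v ?m)"
    using weight by (cases "?m = 0") (auto simp: symmetric_pos_def_def less_imp_le)
  have dens: "prob_density_on Y p"
    using true_densities p by blast
  then have prob: "prob_space (law Y p)"
    by (simp add: prob_density_on_def)
  have int: "integrable (law Y p) (\<lambda>y. increment \<phi> y \<theta>)"
    using integrable_increment[OF dens rule \<theta>] increment_finite p \<theta> by blast
  show "0 < ?m \<bullet> (\<Omega> *v (\<theta>star p - \<theta>)) \<longleftrightarrow>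
    (\<exists>\<kappa>bar>0. \<kappa>bar \<le> 1 \<and>
       (\<forall>\<kappa>. 0 < \<kappa> \<and> \<kappa> \<le> \<kappa>bar \<longrightarrow> delta_CEV Y \<Omega> (\<theta>star p) (downscaled \<phi> \<kappa>) \<theta> p < 0))"
    unfolding delta_CEV_downscaled[OF prob int sym]
    by (rule quadratic_neg_near_zero_iff[OF nonneg])
qed

end
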